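(* Let $\mu$ be a probability measure on $[0,1]$ and let $p>1$. Let $S\subset C([0,1];\mathbb{R})$ be a linear subspace consisting of continuous functions which is a closed subspace of the Banach space $L_{p}(0,1;d\mu)$. Then $S$ is finite-dimensional.
   Context: $C([0,1];\mathbb{R})$ is the space of continuous real-valued functions on $[0,1]$ with the sup norm; $L_p(0,1;d\mu)$ is the Banach space of (classes of) real-valued functions on $[0,1]$ with norm $\|f\|_p=(\int_{[0,1]}|f|^p\,d\mu)^{1/p}$. The subspace $S$ is regarded as a subspace of $L_p(0,1;d\mu)$, i.e. $S$ is a closed linear subspace of $L_p(0,1;d\mu)$ all of whose elements are (represented by) continuous functions. *)

theory Defs
  imports "HOL-Probability.Probability"
begin

section \<open>The space of p-integrable functions\<close>

definition Lp_fun :: "'a measure \<Rightarrow> real \<Rightarrow> ('a \<Rightarrow> real) set" where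
  "Lp_fun M p = {f \<in> borel_measurable M. integrable M (\<lambda>x. \<bar>f x\<bar> powr p)}"

definition Lp_fun_norm :: "'a measure \<Rightarrow> real \<Rightarrow> ('a \<Rightarrow> real) \<Rightarrow> real" where
  "Lp_fun_norm M p f = (\<integral>x. \<bar>f x\<bar> powr p \<partial>M) powr (1 / p)"


section \<open>The normed space of classes modulo almost everywhere equality\<close>

definition Lp_rel :: "'a measure \<Rightarrow> real \<Rightarrow> (('a \<Rightarrow> real) \<times> ('a \<Rightarrow> real)) set" where
  "Lp_rel M p = {(f, g). f \<in> Lp_fun M p \<and> g \<in> Lp_fun M p \<and> (AE x in M. f x = g x)}"

definition Lp :: "'a measure \<Rightarrow> real \<Rightarrow> ('a \<Rightarrow> real) set set" where
  "Lp M p = Lp_fun M p // Lp_rel M p"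

definition Lp_class :: "'a measure \<Rightarrow> real \<Rightarrow> ('a \<Rightarrow> real) \<Rightarrow> ('a \<Rightarrow> real) set" where
  "Lp_class M p f = Lp_rel M p `` {f}"

definition Lp_zero :: "'a measure \<Rightarrow> real \<Rightarrow> ('a \<Rightarrow> real) set" where
  "Lp_zero M p = Lp_class M p (\<lambda>x. 0)"

definition Lp_add ::
    "'a measure \<Rightarrow> real \<Rightarrow> ('a \<Rightarrow> real) set \<Rightarrow> ('a \<Rightarrow> real) set \<Rightarrow> ('a \<Rightarrow> real) set" where
  "Lp_add M p F G = (\<Union>f\<in>F. \<Union>g\<in>G. Lp_class M p (\<lambda>x. f x + g x))"

definition Lp_scale ::
    "'a measure \<Rightarrow> real \<Rightarrow> real \<Rightarrow> ('a \<Rightarrow> real) set \<Rightarrow> ('a \<Rightarrow> real) set" where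
  "Lp_scale M p c F = (\<Union>f\<in>F. Lp_class M p (\<lambda>x. c * f x))"

definition Lp_norm :: "'a measure \<Rightarrow> real \<Rightarrow> ('a \<Rightarrow> real) set \<Rightarrow> real" where
  "Lp_norm M p F = the_elem (Lp_fun_norm M p ` F)"

text \<open>The value 0 off the carrier is needed because the locale \<^locale>\<open>Metric_space\<close>
  demands nonnegativity and symmetry for all arguments.\<close>
definition Lp_dist ::
    "'a measure \<Rightarrow> real \<Rightarrow> ('a \<Rightarrow> real) set \<Rightarrow> ('a \<Rightarrow> real) set \<Rightarrow> real" where
  "Lp_dist M p F G =
     (if F \<in> Lp M p \<and> G \<in> Lp M p then Lp_norm M p (Lp_add M p F (Lp_scale M p (-1) G)) else 0)"

definition Lp_topology :: "'a measure \<Rightarrow> real \<Rightarrow> ('a \<Rightarrow> real) set topology" where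
  "Lp_topology M p = Metric_space.mtopology (Lp M p) (Lp_dist M p)"

definition Lp_subspace :: "'a measure \<Rightarrow> real \<Rightarrow> ('a \<Rightarrow> real) set set \<Rightarrow> bool" where
  "Lp_subspace M p S \<longleftrightarrow>
     S \<subseteq> Lp M p \<and> Lp_zero M p \<in> S \<and>
     (\<forall>F\<in>S. \<forall>G\<in>S. Lp_add M p F G \<in> S) \<and>
     (\<forall>c. \<forall>F\<in>S. Lp_scale M p c F \<in> S)"

text \<open>The hull is the linear span: the smallest subspace containing the given classes.\<close>
definition Lp_finite_dim :: "'a measure \<Rightarrow> real \<Rightarrow> ('a \<Rightarrow> real) set set \<Rightarrow> bool" where
  "Lp_finite_dim M p S \<longleftrightarrow> (\<exists>B. finite B \<and> B \<subseteq> S \<and> S = Lp_subspace M p hull B)"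


section \<open>Well-definedness\<close>

lemma Lp_fun_measurable: "f \<in> Lp_fun M p \<Longrightarrow> f \<in> borel_measurable M"
  by (simp add: Lp_fun_def)

lemma Lp_fun_zero: "(\<lambda>x. 0) \<in> Lp_fun M p"
  by (simp add: Lp_fun_def)

lemma Lp_fun_scale:
  assumes "f \<in> Lp_fun M p"
  shows "(\<lambda>x. c * f x) \<in> Lp_fun M p"
  using assms by (auto simp: Lp_fun_def abs_mult powr_mult)

lemma powr_abs_add_le:
  fixes a b p :: real
  assumes "0 \<le> p"
  shows "\<bar>a + b\<bar> powr p \<le> 2 powr p * (\<bar>a\<bar> powr p + \<bar>b\<bar> powr p)"
proof -
  have "\<bar>a + b\<bar> powr p \<le> (2 * max \<bar>a\<bar> \<bar>b\<bar>) powr p"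
    by (rule powr_mono2) (use assms in auto)
  also have "\<dots> = 2 powr p * max \<bar>a\<bar> \<bar>b\<bar> powr p"
    by (simp add: powr_mult)
  also have "\<dots> \<le> 2 powr p * (\<bar>a\<bar> powr p + \<bar>b\<bar> powr p)"
    by (intro mult_left_mono) (auto simp: max_def)
  finally show ?thesis .
qed

lemma Lp_fun_add:
  assumes "0 \<le> p" "f \<in> Lp_fun M p" "g \<in> Lp_fun M p"
  shows "(\<lambda>x. f x + g x) \<in> Lp_fun M p"
proof -
  have [measurable]: "f \<in> borel_measurable M" "g \<in> borel_measurable M"
    using assms by (auto simp: Lp_fun_def)
  have "integrable M (\<lambda>x. \<bar>f x + g x\<bar> powr p)"
  proof (rule Bochner_Integration.integrable_bound)
    show "integrable M (\<lambda>x. 2 powr p * (\<bar>f x\<bar> powr p + \<bar>g x\<bar> powr p))"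
      using assms by (auto simp: Lp_fun_def)
    show "AE x in M. norm (\<bar>f x + g x\<bar> powr p) \<le> norm (2 powr p * (\<bar>f x\<bar> powr p + \<bar>g x\<bar> powr p))"
      using powr_abs_add_le[OF assms(1)] by auto
  qed measurable
  then show ?thesis by (simp add: Lp_fun_def)
qed

lemma equiv_Lp_rel: "equiv (Lp_fun M p) (Lp_rel M p)"
proof (rule equivI)
  show "Lp_rel M p \<subseteq> Lp_fun M p \<times> Lp_fun M p"
    by (auto simp: Lp_rel_def)
  show "refl_on (Lp_fun M p) (Lp_rel M p)"
    by (auto simp: Lp_rel_def refl_on_def)
  show "sym (Lp_rel M p)"
    by (simp add: Lp_rel_def sym_def eq_commute)
  have "AE x in M. f x = h x" if "AE x in M. f x = g x" "AE x in M. g x = h x" for f g h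
    using that by eventually_elim simp
  then show "trans (Lp_rel M p)"
    unfolding Lp_rel_def trans_def by blast
qed

lemma Lp_class_in_Lp: "f \<in> Lp_fun M p \<Longrightarrow> Lp_class M p f \<in> Lp M p"
  by (simp add: Lp_class_def Lp_def quotientI)

lemma Lp_cases:
  assumes "F \<in> Lp M p"
  obtains f where "f \<in> Lp_fun M p" "F = Lp_class M p f"
  using assms by (auto simp: Lp_class_def Lp_def elim: quotientE)

lemma mem_Lp_class:
  "g \<in> Lp_class M p f \<longleftrightarrow> f \<in> Lp_fun M p \<and> g \<in> Lp_fun M p \<and> (AE x in M. f x = g x)"
  by (auto simp: Lp_class_def Lp_rel_def)

lemma Lp_class_eq_iff:
  assumes "f \<in> Lp_fun M p" "g \<in> Lp_fun M p"
  shows "Lp_class M p f = Lp_class M p g \<longleftrightarrow> (AE x in M. f x = g x)"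
  using eq_equiv_class_iff[OF equiv_Lp_rel assms] assms
  by (simp add: Lp_class_def) (simp add: Lp_rel_def)

lemma Lp_add_class:
  assumes "0 \<le> p" "f \<in> Lp_fun M p" "g \<in> Lp_fun M p"
  shows "Lp_add M p (Lp_class M p f) (Lp_class M p g) = Lp_class M p (\<lambda>x. f x + g x)"
proof -
  have "Lp_class M p (\<lambda>x. f' x + g' x) = Lp_class M p (\<lambda>x. f x + g x)"
    if "f' \<in> Lp_class M p f" "g' \<in> Lp_class M p g" for f' g'
  proof -
    have "AE x in M. f x = f' x" "AE x in M. g x = g' x"
      using that by (simp_all add: mem_Lp_class)
    then have "AE x in M. f' x + g' x = f x + g x"
      by eventually_elim simp
    then show ?thesis
      using that assms by (subst Lp_class_eq_iff) (auto simp: mem_Lp_class intro: Lp_fun_add)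
  qed
  moreover have "f \<in> Lp_class M p f" "g \<in> Lp_class M p g"
    using assms by (auto simp: mem_Lp_class)
  ultimately show ?thesis
    unfolding Lp_add_def by blast
qed

lemma Lp_scale_class:
  assumes "f \<in> Lp_fun M p"
  shows "Lp_scale M p c (Lp_class M p f) = Lp_class M p (\<lambda>x. c * f x)"
proof -
  have "Lp_class M p (\<lambda>x. c * f' x) = Lp_class M p (\<lambda>x. c * f x)"
    if "f' \<in> Lp_class M p f" for f'
  proof -
    have "AE x in M. f x = f' x"
      using that by (simp add: mem_Lp_class)
    then have "AE x in M. c * f' x = c * f x"
      by eventually_elim simp
    then show ?thesis
      using that assms by (subst Lp_class_eq_iff) (auto simp: mem_Lp_class intro: Lp_fun_scale)
  qed
  moreover have "f \<in> Lp_class M p f"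
    using assms by (auto simp: mem_Lp_class)
  ultimately show ?thesis
    unfolding Lp_scale_def by blast
qed

lemma Lp_fun_norm_cong:
  assumes "f \<in> Lp_fun M p" "g \<in> Lp_fun M p" "AE x in M. f x = g x"
  shows "Lp_fun_norm M p f = Lp_fun_norm M p g"
proof -
  have [measurable]: "f \<in> borel_measurable M" "g \<in> borel_measurable M"
    using assms by (auto simp: Lp_fun_def)
  have "(\<integral>x. \<bar>f x\<bar> powr p \<partial>M) = (\<integral>x. \<bar>g x\<bar> powr p \<partial>M)"
    by (rule integral_cong_AE) (use assms(3) in auto)
  then show ?thesis by (simp add: Lp_fun_norm_def)
qed

lemma Lp_norm_class:
  assumes "f \<in> Lp_fun M p"
  shows "Lp_norm M p (Lp_class M p f) = Lp_fun_norm M p f"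
proof -
  have "f \<in> Lp_class M p f"
    using assms by (simp add: mem_Lp_class)
  moreover have "Lp_fun_norm M p g = Lp_fun_norm M p f" if "g \<in> Lp_class M p f" for g
    using that Lp_fun_norm_cong[of f M p g] by (simp add: mem_Lp_class)
  ultimately have "Lp_fun_norm M p ` Lp_class M p f = {Lp_fun_norm M p f}"
    by blast
  then show ?thesis by (simp add: Lp_norm_def)
qed

lemma Lp_dist_class:
  assumes "0 \<le> p" "f \<in> Lp_fun M p" "g \<in> Lp_fun M p"
  shows "Lp_dist M p (Lp_class M p f) (Lp_class M p g) = Lp_fun_norm M p (\<lambda>x. f x - g x)"
proof -
  have 1: "(\<lambda>x. -1 * g x) \<in> Lp_fun M p"
    using assms(3) by (rule Lp_fun_scale)
  have 2: "(\<lambda>x. f x + -1 * g x) \<in> Lp_fun M p"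
    by (rule Lp_fun_add[OF assms(1,2) 1])
  show ?thesis
    unfolding Lp_dist_def Lp_scale_class[OF assms(3)] Lp_add_class[OF assms(1,2) 1]
      Lp_norm_class[OF 2]
    using assms by (simp add: Lp_class_in_Lp)
qed


section \<open>The metric\<close>

lemma Lp_fun_norm_nonneg: "0 \<le> Lp_fun_norm M p f"
  by (simp add: Lp_fun_norm_def)

lemma Lp_fun_norm_powr:
  assumes "0 < p"
  shows "Lp_fun_norm M p f powr p = (\<integral>x. \<bar>f x\<bar> powr p \<partial>M)"
  using assms by (simp add: Lp_fun_norm_def powr_powr)

lemma Lp_fun_norm_eq_0_iff:
  assumes "f \<in> Lp_fun M p"
  shows "Lp_fun_norm M p f = 0 \<longleftrightarrow> (AE x in M. f x = 0)"
  using assms by (simp add: Lp_fun_norm_def Lp_fun_def integral_nonneg_eq_0_iff_AE)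

lemma powr_convex_combination:
  fixes a b t p :: real
  assumes "1 \<le> p" "0 \<le> a" "0 \<le> b" "0 \<le> t" "t \<le> 1"
  shows "(t * a + (1 - t) * b) powr p \<le> t * a powr p + (1 - t) * b powr p"
proof -
  have le: "s powr p \<le> s" if "0 \<le> s" "s \<le> 1" for s :: real
    using powr_mono'[of 1 p s] that assms(1) by simp
  consider "a = 0" | "b = 0" | "0 < a" "0 < b"
    using assms by linarith
  then show ?thesis
  proof cases
    case 1
    then show ?thesis
      using assms le[of "1 - t"] by (simp add: powr_mult mult_right_mono)
  next
    case 2
    then show ?thesis
      using assms le[of t] by (simp add: powr_mult mult_right_mono)
  next
    case 3
    then show ?thesis
      using convex_onD[OF powr_convex[OF assms(1)], of "1 - t" a b] assms by simp
  qed
qed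

lemma Lp_fun_norm_triangle:
  assumes p: "1 \<le> p" and f: "f \<in> Lp_fun M p" and g: "g \<in> Lp_fun M p"
  shows "Lp_fun_norm M p (\<lambda>x. f x + g x) \<le> Lp_fun_norm M p f + Lp_fun_norm M p g"
proof -
  define A where "A = Lp_fun_norm M p f"
  define B where "B = Lp_fun_norm M p g"
  have fg: "(\<lambda>x. f x + g x) \<in> Lp_fun M p"
    using Lp_fun_add[OF _ f g] p by simp
  have "0 \<le> A" "0 \<le> B"
    by (simp_all add: A_def B_def Lp_fun_norm_nonneg)
  then consider "A = 0" | "B = 0" | "0 < A" "0 < B"
    by linarith
  then show ?thesis
  proof cases
    case 1
    then have "AE x in M. f x + g x = g x"
      using Lp_fun_norm_eq_0_iff[OF f] by (simp add: A_def)
    from Lp_fun_norm_cong[OF fg g this] show ?thesis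
      by (simp add: Lp_fun_norm_nonneg)
  next
    case 2
    then have "AE x in M. f x + g x = f x"
      using Lp_fun_norm_eq_0_iff[OF g] by (simp add: B_def)
    from Lp_fun_norm_cong[OF fg f this] show ?thesis
      by (simp add: Lp_fun_norm_nonneg)
  next
    case 3
    define t where "t = A / (A + B)"
    have t: "0 \<le> t" "t \<le> 1" "1 - t = B / (A + B)"
      using 3 by (auto simp: t_def field_simps)
    let ?c = "(A + B) powr p"
    let ?h = "\<lambda>x. ?c * (t * (\<bar>f x\<bar> powr p / A powr p) + (1 - t) * (\<bar>g x\<bar> powr p / B powr p))"
    have bound: "\<bar>f x + g x\<bar> powr p \<le> ?h x" for x
    proof -
      have "\<bar>f x + g x\<bar> powr p \<le> (\<bar>f x\<bar> + \<bar>g x\<bar>) powr p"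
        by (rule powr_mono2) (use p in auto)
      also have "\<bar>f x\<bar> + \<bar>g x\<bar> = (A + B) * (t * (\<bar>f x\<bar> / A) + (1 - t) * (\<bar>g x\<bar> / B))"
        using 3 unfolding t(3) by (simp add: t_def distrib_left)
      also have "\<dots> powr p = ?c * (t * (\<bar>f x\<bar> / A) + (1 - t) * (\<bar>g x\<bar> / B)) powr p"
        using 3 t by (intro powr_mult) 
      also have "\<dots> \<le> ?c * (t * (\<bar>f x\<bar> / A) powr p + (1 - t) * (\<bar>g x\<bar> / B) powr p)"
        using 3 t p by (intro mult_left_mono powr_convex_combination) auto
      also have "\<dots> = ?h x"
        using 3 by (simp add: powr_divide)
      finally show ?thesis .
    qed
    have int: "integrable M (\<lambda>x. \<bar>f x\<bar> powr p)" "integrable M (\<lambda>x. \<bar>g x\<bar> powr p)"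
      "integrable M (\<lambda>x. \<bar>f x + g x\<bar> powr p)"
      using f g fg by (simp_all add: Lp_fun_def)
    have "(\<integral>x. \<bar>f x + g x\<bar> powr p \<partial>M) \<le> (\<integral>x. ?h x \<partial>M)"
      using int bound by (intro integral_mono) auto
    also have "\<dots> = ?c * (t * (A powr p / A powr p) + (1 - t) * (B powr p / B powr p))"
      using int p by (simp add: A_def B_def Lp_fun_norm_powr)
    also have "\<dots> = ?c"
      using 3 by simp
    finally have "Lp_fun_norm M p (\<lambda>x. f x + g x) \<le> ?c powr (1 / p)"
      unfolding Lp_fun_norm_def using p by (intro powr_mono2) auto
    also have "\<dots> = A + B"
      using 3 p by (simp add: powr_powr)
    finally show ?thesis
      by (simp add: A_def B_def)
  qed
qed

lemma Metric_space_Lp: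
  assumes "1 \<le> p"
  shows "Metric_space (Lp M p) (Lp_dist M p)"
proof -
  have p0: "0 \<le> p" using assms by simp
  have diff: "(\<lambda>x. f x - g x) \<in> Lp_fun M p" if "f \<in> Lp_fun M p" "g \<in> Lp_fun M p" for f g
    using Lp_fun_add[OF p0 that(1) Lp_fun_scale[OF that(2), of "-1"]] by simp
  show ?thesis
  proof
    fix F G
    have "0 \<le> Lp_dist M p F G \<and> Lp_dist M p F G = Lp_dist M p G F"
    proof (cases "F \<in> Lp M p \<and> G \<in> Lp M p")
      case True
      then obtain f g where *: "f \<in> Lp_fun M p" "g \<in> Lp_fun M p"
        "F = Lp_class M p f" "G = Lp_class M p g"
        by (metis Lp_cases)
      have "Lp_fun_norm M p (\<lambda>x. f x - g x) = Lp_fun_norm M p (\<lambda>x. g x - f x)"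
        by (simp add: Lp_fun_norm_def abs_minus_commute)
      with * show ?thesis
        by (simp add: Lp_dist_class p0 Lp_fun_norm_nonneg)
    next
      case False
      then show ?thesis by (auto simp: Lp_dist_def)
    qed
    then show "0 \<le> Lp_dist M p F G" "Lp_dist M p F G = Lp_dist M p G F"
      by blast+
  next
    fix F G
    assume "F \<in> Lp M p" "G \<in> Lp M p"
    then obtain f g where *: "f \<in> Lp_fun M p" "g \<in> Lp_fun M p"
      "F = Lp_class M p f" "G = Lp_class M p g"
      by (metis Lp_cases)
    then show "Lp_dist M p F G = 0 \<longleftrightarrow> F = G"
      by (simp add: Lp_dist_class p0 Lp_fun_norm_eq_0_iff diff Lp_class_eq_iff)
  next
    fix F G H
    assume "F \<in> Lp M p" "G \<in> Lp M p" "H \<in> Lp M p"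
    then obtain f g h where *: "f \<in> Lp_fun M p" "g \<in> Lp_fun M p" "h \<in> Lp_fun M p"
      "F = Lp_class M p f" "G = Lp_class M p g" "H = Lp_class M p h"
      by (metis Lp_cases)
    show "Lp_dist M p F H \<le> Lp_dist M p F G + Lp_dist M p G H"
      using Lp_fun_norm_triangle[OF assms diff[OF *(1,2)] diff[OF *(2,3)]] *
      by (simp add: Lp_dist_class p0)
  qed
qed

end

theory Submission
  imports Defs
begin

text \<open>On \<open>S\<close> the essential supremum is bounded by a multiple of the \<open>L\<^sub>p\<close> norm. Otherwise, since
  every element of \<open>S\<close> is essentially bounded, every ball of \<open>S\<close> contains elements of arbitrarily
  large essential supremum; the condition ``essential supremum \<open>> n\<close>'' is stable under small
  \<open>L\<^sub>p\<close> perturbations, so nested balls shrink to a limit which belongs to \<open>S\<close> but is unbounded.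
  The bound upgrades to \<open>f\<^sup>2 \<le> C \<integral> f\<^sup>2\<close> almost everywhere on \<open>S\<close>. For an orthonormal system
  \<open>e\<^sub>i\<close> (\<open>i < n\<close>) in \<open>S\<close>, applying it to all combinations \<open>\<Sum> c\<^sub>i e\<^sub>i\<close> gives
  \<open>\<Sum> e\<^sub>i\<^sup>2 \<le> C\<close> almost everywhere, and integrating gives \<open>n \<le> C\<close>. A maximal orthonormal
  system therefore exists, and it spans \<open>S\<close>.\<close>

section \<open>Rapidly converging series and sequences of p-integrable functions\<close>

lemma Lp_fun_diff:
  assumes "0 \<le> p" "f \<in> Lp_fun M p" "g \<in> Lp_fun M p"
  shows "(\<lambda>x. f x - g x) \<in> Lp_fun M p"
  using Lp_fun_add[OF assms(1,2) Lp_fun_scale[OF assms(3), of "-1"]] by simp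

text \<open>The weights come from \<open>\<Sum>k. (1/2) ^ (k + 1) = 1\<close>: the right-hand side \<open>H\<close> dominates each of
  its terms, so \<open>\<bar>d k\<bar> \<le> H powr (1 / p) * (1/2) ^ (k + 1)\<close>.\<close>
lemma abs_suminf_powr_le:
  fixes d :: "nat \<Rightarrow> real" and p :: real
  assumes p: "0 < p" and sm: "summable (\<lambda>k. 2 powr (p * (k + 1)) * \<bar>d k\<bar> powr p)"
  shows "summable d" "\<bar>\<Sum>k. d k\<bar> powr p \<le> (\<Sum>k. 2 powr (p * (k + 1)) * \<bar>d k\<bar> powr p)"
proof -
  define H where "H = (\<Sum>k. 2 powr (p * (k + 1)) * \<bar>d k\<bar> powr p)"
  have bnd: "\<bar>d k\<bar> \<le> H powr (1/p) * (1/2) ^ Suc k" for k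
  proof -
    have "2 powr (p * (k + 1)) * \<bar>d k\<bar> powr p \<le> H"
      using sum_le_suminf[OF sm, of "{k}"] by (simp add: H_def)
    moreover have "2 powr (p * (k + 1)) * \<bar>d k\<bar> powr p = (2 ^ Suc k * \<bar>d k\<bar>) powr p"
      by (simp add: powr_mult powr_powr mult.commute powr_add distrib_left flip: powr_realpow)
    ultimately have "((2 ^ Suc k * \<bar>d k\<bar>) powr p) powr (1/p) \<le> H powr (1/p)"
      using p by (intro powr_mono2) auto
    then have "2 ^ Suc k * \<bar>d k\<bar> \<le> H powr (1/p)"
      using p by (simp add: powr_powr)
    then show ?thesis by (simp add: field_simps)
  qed
  have sH: "(\<lambda>k. H powr (1/p) * (1/2) ^ Suc k) sums (H powr (1/p))"
    using sums_mult[OF power_half_series, of "H powr (1/p)"] by simp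
  have sa: "summable (\<lambda>k. \<bar>d k\<bar>)"
    by (rule summable_comparison_test'[OF sums_summable[OF sH], of 0]) (use bnd in simp)
  then show "summable d"
    by (rule summable_rabs_cancel)
  have H0: "0 \<le> H"
    unfolding H_def by (intro suminf_nonneg sm) simp
  have "\<bar>\<Sum>k. d k\<bar> \<le> (\<Sum>k. \<bar>d k\<bar>)"
    by (rule summable_rabs[OF sa])
  also have "\<dots> \<le> H powr (1/p)"
    using suminf_le[OF bnd sa sums_summable[OF sH]] sums_unique[OF sH] by simp
  finally have "\<bar>\<Sum>k. d k\<bar> powr p \<le> (H powr (1/p)) powr p"
    using p by (intro powr_mono2) auto
  also have "\<dots> = H"
    using p H0 by (simp add: powr_powr)
  finally show "\<bar>\<Sum>k. d k\<bar> powr p \<le> (\<Sum>k. 2 powr (p * (k + 1)) * \<bar>d k\<bar> powr p)"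
    by (simp add: H_def)
qed

text \<open>The decay rate is chosen to beat the weights of \<open>abs_suminf_powr_le\<close>: the
  weighted integrals still decay like \<open>(1/2) ^ k\<close>. Integrating the weighted series
  termwise therefore gives a finite value, so the series converges almost everywhere, and the same
  value bounds the integral of the p-th power of the sum.\<close>

lemma Lp_fun_series:
  fixes d :: "nat \<Rightarrow> 'a \<Rightarrow> real"
  assumes p: "0 < p" and d: "\<And>k. d k \<in> Lp_fun M p" and \<delta>: "0 \<le> \<delta>"
    and bound: "\<And>k. (\<integral>x. \<bar>d k x\<bar> powr p \<partial>M) \<le> \<delta> * (2 powr (- (p + 1))) ^ k"
  shows "AE x in M. summable (\<lambda>k. d k x)"
    and "(\<lambda>x. \<Sum>k. d k x) \<in> Lp_fun M p"
    and "(\<integral>x. \<bar>\<Sum>k. d k x\<bar> powr p \<partial>M) \<le> 2 powr (p + 1) * \<delta>"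
proof -
  have [measurable]: "d k \<in> borel_measurable M" for k
    using d by (rule Lp_fun_measurable)
  define w where "w k x = 2 powr (p * (real k + 1)) * \<bar>d k x\<bar> powr p" for k x
  have [measurable]: "w k \<in> borel_measurable M" for k
    unfolding w_def by measurable
  have w0: "0 \<le> w k x" for k x
    by (simp add: w_def)
  have wint: "integrable M (\<lambda>x. w k x)" for k
    using d[of k] unfolding w_def Lp_fun_def by simp
  have wle: "(\<integral>x. w k x \<partial>M) \<le> 2 powr p * \<delta> * (1/2) ^ k" for k
  proof -
    have "(\<integral>x. w k x \<partial>M) = 2 powr (p * (real k + 1)) * (\<integral>x. \<bar>d k x\<bar> powr p \<partial>M)"
      by (simp add: w_def)
    also have "\<dots> \<le> 2 powr (p * (real k + 1)) * (\<delta> * (2 powr (- (p + 1))) ^ k)"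
      by (intro mult_left_mono bound) simp
    also have "(2 powr (- (p + 1))) ^ k = 2 powr (- (p + 1) * k)"
      by (simp add: powr_realpow[symmetric] powr_powr)
    also have "2 powr (p * (real k + 1)) * (\<delta> * 2 powr (- (p + 1) * k))
        = \<delta> * (2 powr (p * (real k + 1)) * 2 powr (- (p + 1) * k))"
      by simp
    \<comment> \<open>The exponents add up to p * (k + 1) - (p + 1) * k = p - k; the extra 1 in the
      rate is what leaves a summable factor.\<close>
    also have "2 powr (p * (real k + 1)) * 2 powr (- (p + 1) * k) = 2 powr (p + (- real k))"
      unfolding powr_add[symmetric] by (simp add: algebra_simps)
    also have "\<dots> = 2 powr p * (1/2) ^ k"
      unfolding powr_add by (simp add: powr_minus powr_realpow power_one_over inverse_eq_divide)
    finally show ?thesis by (simp add: mult_ac)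
  qed
  have sums: "(\<lambda>k. 2 powr p * \<delta> * (1/2) ^ k) sums (2 powr (p + 1) * \<delta>)"
    using sums_mult[OF geometric_sums[of "1/2::real"], of "2 powr p * \<delta>"]
    by (simp add: powr_add mult_ac)
  have "(\<integral>\<^sup>+x. (\<Sum>k. ennreal (w k x)) \<partial>M) = (\<Sum>k. \<integral>\<^sup>+x. ennreal (w k x) \<partial>M)"
    by (rule nn_integral_suminf) measurable
  also have "\<dots> = (\<Sum>k. ennreal (\<integral>x. w k x \<partial>M))"
    by (simp add: nn_integral_eq_integral wint w0)
  also have "\<dots> \<le> (\<Sum>k. ennreal (2 powr p * \<delta> * (1/2) ^ k))"
    by (intro suminf_le ennreal_leI wle) auto
  also have "\<dots> = ennreal (2 powr (p + 1) * \<delta>)"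
    using sums \<delta> by (intro suminf_ennreal_eq) auto
  finally have nn: "(\<integral>\<^sup>+x. (\<Sum>k. ennreal (w k x)) \<partial>M) \<le> ennreal (2 powr (p + 1) * \<delta>)" .
  have "AE x in M. (\<Sum>k. ennreal (w k x)) \<noteq> \<infinity>"
    by (rule nn_integral_PInf_AE) (use nn in \<open>auto simp: top_unique\<close>)
  then have ws: "AE x in M. summable (\<lambda>k. w k x)"
    by eventually_elim (rule summable_suminf_not_top, auto simp: w0)
  show "AE x in M. summable (\<lambda>k. d k x)"
    using ws by eventually_elim (rule abs_suminf_powr_le(1)[OF p], simp add: w_def add.commute)
  have le: "AE x in M. ennreal (\<bar>\<Sum>k. d k x\<bar> powr p) \<le> (\<Sum>k. ennreal (w k x))"
    using ws
  proof eventually_elim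
    case (elim x)
    have "\<bar>\<Sum>k. d k x\<bar> powr p \<le> (\<Sum>k. w k x)"
      using abs_suminf_powr_le(2)[OF p] elim by (simp add: w_def add.commute)
    then show ?case
      by (subst suminf_ennreal2[OF w0 elim]) (rule ennreal_leI)
  qed
  have nn2: "(\<integral>\<^sup>+x. ennreal (\<bar>\<Sum>k. d k x\<bar> powr p) \<partial>M) \<le> ennreal (2 powr (p + 1) * \<delta>)"
    using nn_integral_mono_AE[OF le] nn by simp
  show int: "(\<lambda>x. \<Sum>k. d k x) \<in> Lp_fun M p"
    unfolding Lp_fun_def
  proof (intro CollectI conjI)
    show "integrable M (\<lambda>x. \<bar>\<Sum>k. d k x\<bar> powr p)"
      by (rule integrableI_bounded) (use nn2 in \<open>auto simp: le_less_trans\<close>)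
  qed measurable
  have "ennreal (\<integral>x. \<bar>\<Sum>k. d k x\<bar> powr p \<partial>M) \<le> ennreal (2 powr (p + 1) * \<delta>)"
    using nn2 int by (subst nn_integral_eq_integral[symmetric]) (auto simp: Lp_fun_def)
  then show "(\<integral>x. \<bar>\<Sum>k. d k x\<bar> powr p \<partial>M) \<le> 2 powr (p + 1) * \<delta>"
    using \<delta> by (simp add: ennreal_le_iff)
qed

text \<open>Completeness with an explicit rate. The tail of the telescoping series from any index
  \<open>n\<close> satisfies the hypotheses of \<open>Lp_fun_series\<close> with \<delta> n in place
  of \<delta>, so one limit is close to every \<open>u n\<close> on the scale of that
  \<open>n\<close>. Distances are integrals of p-th powers, without the root.\<close>

lemma Lp_fun_telescoping_limit:
  fixes u :: "nat \<Rightarrow> 'a \<Rightarrow> real"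
  assumes p: "0 < p" and u: "\<And>n. u n \<in> Lp_fun M p" and \<delta>: "\<And>n. 0 \<le> \<delta> n"
    and \<delta>_Suc: "\<And>n. \<delta> (Suc n) \<le> 2 powr (- (p + 1)) * \<delta> n"
    and bound: "\<And>n. (\<integral>x. \<bar>u (Suc n) x - u n x\<bar> powr p \<partial>M) \<le> \<delta> n"
  obtains g where "g \<in> Lp_fun M p"
    "\<And>n. (\<integral>x. \<bar>g x - u n x\<bar> powr p \<partial>M) \<le> 2 powr (p + 1) * \<delta> n"
proof -
  define d where "d n k x = u (Suc (n + k)) x - u (n + k) x" for n k x
  have dL: "d n k \<in> Lp_fun M p" for n k
    unfolding d_def using p u by (intro Lp_fun_diff) auto
  have \<delta>_le: "\<delta> (n + k) \<le> \<delta> n * (2 powr (- (p + 1))) ^ k" for n k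
  proof (induction k)
    case (Suc k)
    have "\<delta> (n + Suc k) \<le> 2 powr (- (p + 1)) * \<delta> (n + k)"
      using \<delta>_Suc[of "n + k"] by simp
    also have "\<dots> \<le> 2 powr (- (p + 1)) * (\<delta> n * (2 powr (- (p + 1))) ^ k)"
      by (intro mult_left_mono Suc) simp
    finally show ?case by (simp add: mult_ac)
  qed simp
  have dle: "(\<integral>x. \<bar>d n k x\<bar> powr p \<partial>M) \<le> \<delta> n * (2 powr (- (p + 1))) ^ k" for n k
    using bound[of "n + k"] \<delta>_le[of n k] by (simp add: d_def)
  note series = Lp_fun_series[OF p dL \<delta> dle]
  define g where "g x = u 0 x + (\<Sum>k. d 0 k x)" for x
  have gL: "g \<in> Lp_fun M p"
    unfolding g_def using p u series(2) by (intro Lp_fun_add) auto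
  have "(\<integral>x. \<bar>g x - u n x\<bar> powr p \<partial>M) \<le> 2 powr (p + 1) * \<delta> n" for n
  proof -
    \<comment> \<open>\<open>g\<close> is built from the series that starts at index 0. Its first
      \<open>n\<close> terms telescope to \<open>u n x - u 0 x\<close>, and the remaining ones are
      exactly the terms \<open>d n k x\<close>.\<close>
    have "AE x in M. g x - u n x = (\<Sum>k. d n k x)"
      using series(1)[of 0]
    proof eventually_elim
      case (elim x)
      have "(\<Sum>k<n. d 0 k x) = u n x - u 0 x"
        using sum_lessThan_telescope[of "\<lambda>k. u k x" n] by (simp add: d_def)
      moreover have "(\<Sum>k. d 0 k x) = (\<Sum>k. d 0 (k + n) x) + (\<Sum>k<n. d 0 k x)"
        by (rule suminf_split_initial_segment[OF elim])
      ultimately show ?case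
        by (simp add: g_def d_def add.commute)
    qed
    moreover have "(\<lambda>x. g x - u n x) \<in> borel_measurable M"
      using gL u by (intro borel_measurable_diff) (auto simp: Lp_fun_def)
    moreover have "(\<lambda>x. \<Sum>k. d n k x) \<in> borel_measurable M"
      using series(2) by (rule Lp_fun_measurable)
    ultimately have "(\<integral>x. \<bar>g x - u n x\<bar> powr p \<partial>M) = (\<integral>x. \<bar>\<Sum>k. d n k x\<bar> powr p \<partial>M)"
      by (intro integral_cong_AE) auto
    with series(3) show ?thesis by simp
  qed
  with gL show ?thesis by (rule that)
qed

section \<open>A uniform essential bound on the unit ball, by nested balls\<close>

text \<open>If \<open>f\<close> exceeds \<open>K\<close> on a set of positive measure, the excess
  \<open>max 0 (\<bar>f x\<bar> - K)\<close> has a p-th power with positive integral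
  \<open>I\<close>. A function \<open>g\<close> essentially bounded by \<open>K\<close> differs from
  \<open>f\<close> by at least this excess, so it cannot come within \<open>I / 2\<close> of
  \<open>f\<close>.\<close>

lemma essential_bound_lower_semicontinuous:
  assumes p: "0 < p" and f: "f \<in> Lp_fun M p" and K: "0 \<le> K" and nb: "\<not> (AE x in M. \<bar>f x\<bar> \<le> K)"
  obtains r where "0 < r"
    "\<And>g. g \<in> Lp_fun M p \<Longrightarrow> (\<integral>x. \<bar>g x - f x\<bar> powr p \<partial>M) \<le> r \<Longrightarrow> \<not> (AE x in M. \<bar>g x\<bar> \<le> K)"
proof -
  have [measurable]: "f \<in> borel_measurable M"
    using f by (rule Lp_fun_measurable)
  define I where "I = (\<integral>x. max 0 (\<bar>f x\<bar> - K) powr p \<partial>M)"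
  have int: "integrable M (\<lambda>x. max 0 (\<bar>f x\<bar> - K) powr p)"
  proof (rule Bochner_Integration.integrable_bound)
    show "integrable M (\<lambda>x. \<bar>f x\<bar> powr p)"
      using f by (simp add: Lp_fun_def)
    show "AE x in M. norm (max 0 (\<bar>f x\<bar> - K) powr p) \<le> norm (\<bar>f x\<bar> powr p)"
      using p K by (intro AE_I2) (auto intro!: powr_mono2)
  qed measurable
  have "I \<noteq> 0"
  proof
    assume "I = 0"
    then have "AE x in M. max 0 (\<bar>f x\<bar> - K) powr p = 0"
      using integral_nonneg_eq_0_iff_AE[OF int] by (simp add: I_def)
    then have "AE x in M. \<bar>f x\<bar> \<le> K"
      by eventually_elim auto
    with nb show False by simp
  qed
  moreover have "0 \<le> I"
    by (simp add: I_def)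
  ultimately have "0 < I" by simp
  show ?thesis
  proof (rule that[of "I / 2"])
    fix g assume g: "g \<in> Lp_fun M p" and le: "(\<integral>x. \<bar>g x - f x\<bar> powr p \<partial>M) \<le> I / 2"
    show "\<not> (AE x in M. \<bar>g x\<bar> \<le> K)"
    proof
      assume "AE x in M. \<bar>g x\<bar> \<le> K"
      then have "AE x in M. max 0 (\<bar>f x\<bar> - K) powr p \<le> \<bar>g x - f x\<bar> powr p"
        by eventually_elim (use p in \<open>auto intro!: powr_mono2\<close>)
      then have "I \<le> (\<integral>x. \<bar>g x - f x\<bar> powr p \<partial>M)"
        unfolding I_def using Lp_fun_diff[OF _ g f] p
        by (intro integral_mono_AE int) (auto simp: Lp_fun_def)
      with le \<open>0 < I\<close> show False by simp
    qed
  qed (use \<open>0 < I\<close> in simp)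
qed

text \<open>A Baire category argument done by hand: if no \<open>K\<close> works, then for each
  \<open>n\<close> the elements violating the bound \<open>n\<close> are dense in \<open>V\<close>,
  and they form an open set by the preceding lemma. A point lying in all these sets would be an
  element of \<open>V\<close> that is not essentially bounded.\<close>

lemma uniform_essential_bound:
  fixes V :: "('a \<Rightarrow> real) set"
  assumes p: "0 < p" and V: "V \<subseteq> Lp_fun M p"
    and add: "\<And>f g. f \<in> V \<Longrightarrow> g \<in> V \<Longrightarrow> (\<lambda>x. f x + g x) \<in> V"
    and scale: "\<And>c f. f \<in> V \<Longrightarrow> (\<lambda>x. c * f x) \<in> V"
    and zero: "(\<lambda>x. 0) \<in> V"
    and bounded: "\<And>f. f \<in> V \<Longrightarrow> \<exists>B. AE x in M. \<bar>f x\<bar> \<le> B"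
    and closed: "\<And>u g. (\<And>n. u n \<in> V) \<Longrightarrow> g \<in> Lp_fun M p \<Longrightarrow>
      (\<lambda>n. \<integral>x. \<bar>g x - u n x\<bar> powr p \<partial>M) \<longlonglongrightarrow> 0 \<Longrightarrow> g \<in> V"
  shows "\<exists>K>0. \<forall>f\<in>V. (\<integral>x. \<bar>f x\<bar> powr p \<partial>M) \<le> 1 \<longrightarrow> (AE x in M. \<bar>f x\<bar> \<le> K)"
proof (rule ccontr)
  assume neg: "\<not> ?thesis"
  \<comment> \<open>Density and openness in one statement: \<open>y\<close> is the new centre,
    \<open>r\<close> its radius. The factor \<open>2 powr (p + 1)\<close> enlarges the protected
    ball to the accuracy with which \<open>Lp_fun_telescoping_limit\<close> locates the
    limit.\<close>
  have large: "\<exists>y r. y \<in> V \<and> (\<integral>x. \<bar>y x - f x\<bar> powr p \<partial>M) \<le> \<delta> \<and> 0 < r \<and> r \<le> \<eta> \<and>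
      (\<forall>g\<in>Lp_fun M p. (\<integral>x. \<bar>g x - y x\<bar> powr p \<partial>M) \<le> 2 powr (p + 1) * r \<longrightarrow>
         \<not> (AE x in M. \<bar>g x\<bar> \<le> real n))"
    if f: "f \<in> V" and \<delta>: "0 < \<delta>" and \<eta>: "0 < \<eta>" for f \<delta> \<eta> n
  proof -
    obtain B where B: "AE x in M. \<bar>f x\<bar> \<le> B"
      using bounded[OF f] by blast
    \<comment> \<open>With this \<open>c\<close>, adding \<open>c * h\<close> moves \<open>f\<close>
      by at most \<delta>. The constant \<open>K\<close> below is chosen so that the bound
      \<open>n\<close> on \<open>y\<close>, together with the bound \<open>B\<close> on
      \<open>f\<close>, would force \<bar>h\<bar> \<le> \<open>K\<close>; the maximum with 1 keeps
      \<open>K\<close> positive.\<close>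
    define c where "c = \<delta> powr (1 / p)"
    have c: "0 < c" using \<delta> by (simp add: c_def)
    define K where "K = max 1 ((real n + B) / c)"
    have "0 < K" by (simp add: K_def)
    with neg obtain h where h: "h \<in> V" "(\<integral>x. \<bar>h x\<bar> powr p \<partial>M) \<le> 1"
      "\<not> (AE x in M. \<bar>h x\<bar> \<le> K)"
      by blast
    define y where "y x = f x + c * h x" for x
    have yV: "y \<in> V"
      unfolding y_def by (intro add scale f h)
    have "(\<integral>x. \<bar>y x - f x\<bar> powr p \<partial>M) = \<delta> * (\<integral>x. \<bar>h x\<bar> powr p \<partial>M)"
      using c p \<delta> by (simp add: y_def abs_mult powr_mult c_def powr_powr)
    also have "\<dots> \<le> \<delta>"
      using h(2) \<delta> mult_left_mono[of _ 1 \<delta>] by simp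
    finally have dist: "(\<integral>x. \<bar>y x - f x\<bar> powr p \<partial>M) \<le> \<delta>" .
    have "\<not> (AE x in M. \<bar>y x\<bar> \<le> real n)"
    proof
      assume "AE x in M. \<bar>y x\<bar> \<le> real n"
      with B have "AE x in M. \<bar>h x\<bar> \<le> K"
      proof eventually_elim
        case (elim x)
        have "\<bar>c * h x\<bar> \<le> real n + B"
          using elim by (simp add: y_def)
        then have "\<bar>h x\<bar> \<le> (real n + B) / c"
          using c by (simp add: abs_mult field_simps)
        then show ?case by (simp add: K_def)
      qed
      with h(3) show False by simp
    qed
    from essential_bound_lower_semicontinuous[OF p subsetD[OF V yV] _ this]
    obtain r where r: "0 < r" "\<And>g. g \<in> Lp_fun M p \<Longrightarrow> (\<integral>x. \<bar>g x - y x\<bar> powr p \<partial>M) \<le> r \<Longrightarrow>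
        \<not> (AE x in M. \<bar>g x\<bar> \<le> real n)"
      by auto
    define s where "s = min \<eta> (r / 2 powr (p + 1))"
    have "0 < s" "s \<le> \<eta>"
      using r \<eta> by (auto simp: s_def)
    moreover have "2 powr (p + 1) * s \<le> r"
    proof -
      have "s \<le> r / 2 powr (p + 1)" by (simp add: s_def)
      then show ?thesis by (simp add: pos_le_divide_eq mult.commute)
    qed
    ultimately show ?thesis
      using yV dist r by (intro exI[of _ y] exI[of _ s]) force
  qed
  \<comment> \<open>A pair is a centre with a radius. \<open>P n\<close> says that the enlarged ball
    avoids the functions bounded by \<open>n\<close>; \<open>Q\<close> puts the next centre in the
    current ball and shrinks the radius at the rate required for the limit.\<close>
  define P where "P n a \<longleftrightarrow> fst a \<in> V \<and> 0 < snd a \<and>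
    (\<forall>g\<in>Lp_fun M p. (\<integral>x. \<bar>g x - fst a x\<bar> powr p \<partial>M) \<le> 2 powr (p + 1) * snd a \<longrightarrow>
      \<not> (AE x in M. \<bar>g x\<bar> \<le> real n))" for n :: nat and a :: "('a \<Rightarrow> real) \<times> real"
  define Q where "Q a b \<longleftrightarrow> (\<integral>x. \<bar>fst b x - fst a x\<bar> powr p \<partial>M) \<le> snd a \<and>
    snd b \<le> 2 powr (- (p + 1)) * snd a" for a b :: "('a \<Rightarrow> real) \<times> real"
  have "\<exists>w. \<forall>n. P n (w n) \<and> Q (w n) (w (Suc n))"
  proof (rule dependent_nat_choice)
    show "\<exists>a. P 0 a"
      using large[OF zero, of 1 1 0] unfolding P_def by force
    show "\<exists>b. P (Suc n) b \<and> Q a b" if "P n a" for n a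
    proof -
      have "fst a \<in> V" "0 < snd a" "0 < 2 powr (- (p + 1)) * snd a"
        using that by (auto simp: P_def)
      from large[OF this, of "Suc n"] show ?thesis
        unfolding P_def Q_def by force
    qed
  qed
  then obtain w where w: "\<And>n. P n (w n)" "\<And>n. Q (w n) (w (Suc n))"
    by blast
  define u where "u n = fst (w n)" for n
  define \<delta> where "\<delta> n = snd (w n)" for n
  have u: "u n \<in> V" for n
    using w(1)[of n] by (simp add: P_def u_def)
  have \<delta>0: "0 < \<delta> n" for n
    using w(1)[of n] by (simp add: P_def \<delta>_def)
  have \<delta>_Suc: "\<delta> (Suc n) \<le> 2 powr (- (p + 1)) * \<delta> n" for n
    using w(2)[of n] by (simp add: Q_def \<delta>_def)
  obtain g where g: "g \<in> Lp_fun M p"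
    "\<And>n. (\<integral>x. \<bar>g x - u n x\<bar> powr p \<partial>M) \<le> 2 powr (p + 1) * \<delta> n"
  proof (rule Lp_fun_telescoping_limit[of p u M \<delta>])
    show "(\<integral>x. \<bar>u (Suc n) x - u n x\<bar> powr p \<partial>M) \<le> \<delta> n" for n
      using w(2)[of n] by (simp add: Q_def u_def \<delta>_def)
  qed (use p u V \<delta>0 \<delta>_Suc in \<open>auto intro: less_imp_le\<close>)
  have \<delta>_half: "\<delta> n \<le> \<delta> 0 * (1/2) ^ n" for n
  proof (induction n)
    case (Suc n)
    have "2 powr (- (p + 1)) \<le> (2::real) powr (- 1)"
      using p by (intro powr_mono) auto
    then have "2 powr (- (p + 1)) * \<delta> n \<le> (1/2) * \<delta> n"
      using \<delta>0[of n] by (intro mult_right_mono) (auto simp: powr_minus)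
    with \<delta>_Suc[of n] Suc show ?case by simp
  qed simp
  have "(\<lambda>n. 2 powr (p + 1) * (\<delta> 0 * (1/2) ^ n)) \<longlonglongrightarrow> 2 powr (p + 1) * (\<delta> 0 * 0)"
    by (intro tendsto_mult tendsto_const LIMSEQ_realpow_zero) auto
  then have lim: "(\<lambda>n. 2 powr (p + 1) * (\<delta> 0 * (1/2) ^ n)) \<longlonglongrightarrow> 0"
    by simp
  have "(\<lambda>n. \<integral>x. \<bar>g x - u n x\<bar> powr p \<partial>M) \<longlonglongrightarrow> 0"
  proof (rule tendsto_sandwich[OF _ _ tendsto_const lim])
    have "(\<integral>x. \<bar>g x - u n x\<bar> powr p \<partial>M) \<le> 2 powr (p + 1) * (\<delta> 0 * (1/2) ^ n)" for n
      by (rule order_trans[OF g(2) mult_left_mono[OF \<delta>_half]]) simp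
    then show "\<forall>\<^sub>F n in sequentially. (\<integral>x. \<bar>g x - u n x\<bar> powr p \<partial>M)
        \<le> 2 powr (p + 1) * (\<delta> 0 * (1/2) ^ n)"
      by (intro always_eventually allI)
  qed simp
  then have "g \<in> V"
    using closed u g(1) by blast
  then obtain B where B: "AE x in M. \<bar>g x\<bar> \<le> B"
    using bounded by blast
  \<comment> \<open>The limit lies in the enlarged ball of every stage, in particular of one whose
    index is at least its own essential bound.\<close>
  have "AE x in M. \<bar>g x\<bar> \<le> real (nat \<lceil>B\<rceil>)"
    using B by eventually_elim linarith
  with w(1)[of "nat \<lceil>B\<rceil>"] g show False
    unfolding P_def u_def \<delta>_def by blast
qed

section \<open>From the p-norm to the square integral\<close>

text \<open>The proof integrates \<open>\<bar>g\<bar> powr p \<le> \<delta> powr p + g\<^sup>2 / \<delta>\<^sup>2\<close>, valid when \<open>\<bar>g\<bar> \<le> 1\<close>, with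
  \<open>\<delta> powr p = a / 2\<close>; this treats \<open>p \<le> 2\<close> and \<open>p > 2\<close> alike.\<close>
lemma integral_square_lower_bound:
  fixes g :: "'a \<Rightarrow> real" and a p :: real
  assumes p: "0 < p" and M: "prob_space M" and g: "g \<in> borel_measurable M"
    and le1: "AE x in M. \<bar>g x\<bar> \<le> 1" and a: "0 < a" "a \<le> (\<integral>x. \<bar>g x\<bar> powr p \<partial>M)"
  shows "(a / 2) powr (2 / p) * (a / 2) \<le> (\<integral>x. (g x)\<^sup>2 \<partial>M)"
proof -
  interpret prob_space M by (rule M)
  note [measurable] = g
  define \<delta> where "\<delta> = (a / 2) powr (1 / p)"
  have \<delta>: "0 < \<delta>" "\<delta> powr p = a / 2" "\<delta>\<^sup>2 = (a / 2) powr (2 / p)"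
    using p a by (simp_all add: \<delta>_def powr_powr powr_power)
  have sq1: "AE x in M. (g x)\<^sup>2 \<le> 1"
    using le1 by eventually_elim (simp add: abs_square_le_1)
  have int: "integrable M (\<lambda>x. (g x)\<^sup>2)"
    by (rule integrable_const_bound[of _ 1]) (use sq1 in auto)
  have intp: "integrable M (\<lambda>x. \<bar>g x\<bar> powr p)"
  proof (rule integrable_const_bound[of _ 1])
    show "AE x in M. norm (\<bar>g x\<bar> powr p) \<le> 1"
      using le1 by eventually_elim (use p in \<open>auto intro: powr_le1\<close>)
  qed measurable
  have "AE x in M. \<bar>g x\<bar> powr p \<le> \<delta> powr p + (g x)\<^sup>2 / \<delta>\<^sup>2"
    using le1
  proof eventually_elim
    case (elim x)
    show ?case
    proof (cases "\<bar>g x\<bar> \<le> \<delta>")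
      case True
      then have "\<bar>g x\<bar> powr p \<le> \<delta> powr p"
        using p by (intro powr_mono2) auto
      moreover have "0 \<le> (g x)\<^sup>2 / \<delta>\<^sup>2" by simp
      ultimately show ?thesis by linarith
    next
      case False
      then have "\<delta>\<^sup>2 \<le> (g x)\<^sup>2"
        using \<delta>(1) by (intro abs_le_square_iff[THEN iffD1]) simp
      then have "1 \<le> (g x)\<^sup>2 / \<delta>\<^sup>2"
        using \<delta>(1) by simp
      moreover have "\<bar>g x\<bar> powr p \<le> 1"
        using p elim by (intro powr_le1) auto
      ultimately show ?thesis
        using powr_ge_zero[of \<delta> p] by linarith
    qed
  qed
  then have "(\<integral>x. \<bar>g x\<bar> powr p \<partial>M) \<le> (\<integral>x. \<delta> powr p + (g x)\<^sup>2 / \<delta>\<^sup>2 \<partial>M)"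
    by (intro integral_mono_AE intp Bochner_Integration.integrable_add integrable_divide int) auto
  also have "\<dots> = \<delta> powr p + (\<integral>x. (g x)\<^sup>2 \<partial>M) / \<delta>\<^sup>2"
    using int by (simp add: prob_space)
  \<comment> \<open>Half of \<open>a\<close> is absorbed by \<open>\<delta> powr p\<close>; the
    other half must come from the square integral.\<close>
  finally have "a / 2 \<le> (\<integral>x. (g x)\<^sup>2 \<partial>M) / \<delta>\<^sup>2"
    using a \<delta>(2) by linarith
  then show ?thesis
    using \<delta>(1) by (simp add: pos_le_divide_eq mult.commute flip: \<delta>(3))
qed

text \<open>Both sides scale quadratically. Dividing \<open>f\<close> by \<open>K\<close> times its
  p-norm gives a function essentially bounded by 1 whose p-th power has integral
  \<open>1 / K powr p\<close>. By \<open>integral_square_lower_bound\<close> its square integral is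
  at least a constant \<open>c\<close> independent of \<open>f\<close>, and \<open>1 / c\<close>
  serves as \<open>C\<close>. Functions of norm zero are treated apart.\<close>

lemma essential_bound_by_square_integral:
  assumes p: "0 < p" and M: "prob_space M" and V: "V \<subseteq> Lp_fun M p"
    and scale: "\<And>c f. f \<in> V \<Longrightarrow> (\<lambda>x. c * f x) \<in> V"
    and K: "0 < K" "\<And>f. f \<in> V \<Longrightarrow> (\<integral>x. \<bar>f x\<bar> powr p \<partial>M) \<le> 1 \<Longrightarrow> AE x in M. \<bar>f x\<bar> \<le> K"
  shows "\<exists>C>0. \<forall>f\<in>V. AE x in M. (f x)\<^sup>2 \<le> C * (\<integral>x. (f x)\<^sup>2 \<partial>M)"
proof -
  define a where "a = 1 / K powr p"
  define c where "c = (a / 2) powr (2 / p) * (a / 2)"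
  have a: "0 < a" and c: "0 < c"
    using K(1) by (simp_all add: a_def c_def)
  show ?thesis
  proof (intro exI[of _ "1 / c"] conjI ballI)
    fix f assume f: "f \<in> V"
    then have fL: "f \<in> Lp_fun M p" using V by blast
    define I where "I = (\<integral>x. \<bar>f x\<bar> powr p \<partial>M)"
    have "0 \<le> I" by (simp add: I_def)
    show "AE x in M. (f x)\<^sup>2 \<le> 1 / c * (\<integral>x. (f x)\<^sup>2 \<partial>M)"
    proof (cases "I = 0")
      case True
      then have "AE x in M. f x = 0"
        using Lp_fun_norm_eq_0_iff[OF fL] by (simp add: Lp_fun_norm_def I_def)
      then show ?thesis
        by eventually_elim (use c in simp)
    next
      case False
      with \<open>0 \<le> I\<close> have I: "0 < I" by simp
      define t where "t = I powr (1 / p)"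
      have t: "0 < t" "t powr p = I"
        using I p by (simp_all add: t_def powr_powr)
      have scaled: "(\<integral>x. \<bar>r * f x\<bar> powr p \<partial>M) = r powr p * I" if "0 \<le> r" for r
        using that by (simp add: abs_mult powr_mult I_def)
      have "(\<integral>x. \<bar>(1 / t) * f x\<bar> powr p \<partial>M) = 1"
        using t I by (subst scaled) (auto simp: powr_divide)
      then have "AE x in M. \<bar>(1 / t) * f x\<bar> \<le> K"
        using scale[OF f, of "1 / t"] by (intro K(2)) auto
      then have b1: "AE x in M. \<bar>(1 / (K * t)) * f x\<bar> \<le> 1"
        by eventually_elim (use t K(1) in \<open>simp add: abs_mult field_simps\<close>)
      have "(\<integral>x. \<bar>(1 / (K * t)) * f x\<bar> powr p \<partial>M) = a"
        using t I K(1) by (subst scaled) (auto simp: powr_divide powr_mult a_def)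
      then have "c \<le> (\<integral>x. ((1 / (K * t)) * f x)\<^sup>2 \<partial>M)"
        unfolding c_def using fL
        by (intro integral_square_lower_bound p M b1 a borel_measurable_times) (auto simp: Lp_fun_def)
      also have "\<dots> = (1 / (K * t))\<^sup>2 * (\<integral>x. (f x)\<^sup>2 \<partial>M)"
        unfolding power_mult_distrib by simp
      finally have "(K * t)\<^sup>2 \<le> 1 / c * (\<integral>x. (f x)\<^sup>2 \<partial>M)"
        using c t K(1) by (simp add: field_simps)
      moreover have "AE x in M. (f x)\<^sup>2 \<le> (K * t)\<^sup>2"
        using b1
      proof eventually_elim
        case (elim x)
        then have "\<bar>f x\<bar> \<le> \<bar>K * t\<bar>"
          using t K(1) by (simp add: abs_mult field_simps)
        then show ?case by (simp only: abs_le_square_iff)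
      qed
      ultimately show ?thesis by auto
    qed
  qed (use c in simp)
qed

section \<open>Orthonormal systems and their length\<close>

text \<open>The exceptional null set depends on the coefficients, so only countably many of them
  can be treated at once; the point-dependent choice \<open>c i = e i x\<close> is then reached by density.\<close>
lemma AE_sum_squares_le:
  fixes e :: "nat \<Rightarrow> 'a \<Rightarrow> real"
  assumes "0 \<le> C"
    and bound: "\<And>c. AE x in M. (\<Sum>i<n. c i * e i x)\<^sup>2 \<le> C * (\<Sum>i<n. (c i)\<^sup>2)"
  shows "AE x in M. (\<Sum>i<n. (e i x)\<^sup>2) \<le> C"
proof -
  \<comment> \<open>Rational lists form a countable type that covers all rational coefficient
    vectors. On lists shorter than \<open>n\<close>, \<open>l ! i\<close> is some unspecified
    rational, which is harmless because \<open>bound\<close> holds for arbitrary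
    coefficients.\<close>
  have "AE x in M. \<forall>l :: rat list. (\<Sum>i<n. of_rat (l ! i) * e i x)\<^sup>2 \<le> C * (\<Sum>i<n. (of_rat (l ! i))\<^sup>2)"
    using bound by (subst AE_all_countable) (intro allI)
  moreover have "(\<Sum>i<n. (e i x)\<^sup>2) \<le> C"
    if rat: "\<forall>l :: rat list. (\<Sum>i<n. of_rat (l ! i) * e i x)\<^sup>2 \<le> C * (\<Sum>i<n. (of_rat (l ! i))\<^sup>2)" for x
  proof -
    have "\<exists>q. \<forall>k. e i x < of_rat (q k) \<and> of_rat (q k) < e i x + 1 / Suc k" for i
      by (rule choice) (auto intro!: of_rat_dense)
    then obtain q where q: "\<And>i k. e i x < of_rat (q i k)" "\<And>i k. of_rat (q i k) < e i x + 1 / Suc k"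
      by metis
    have lim: "(\<lambda>k. real_of_rat (q i k)) \<longlonglongrightarrow> e i x" for i
    proof (rule tendsto_sandwich[of "\<lambda>_. e i x" _ _ "\<lambda>k. e i x + 1 / Suc k"])
      show "(\<lambda>k. e i x + 1 / Suc k) \<longlonglongrightarrow> e i x"
        using tendsto_add[OF tendsto_const LIMSEQ_Suc[OF lim_1_over_n], of "e i x"] by simp
    qed (auto intro!: always_eventually less_imp_le q simp del: of_nat_Suc)
    have "(\<Sum>i<n. of_rat (q i k) * e i x)\<^sup>2 \<le> C * (\<Sum>i<n. (of_rat (q i k))\<^sup>2)" for k
      using rat[rule_format, of "map (\<lambda>i. q i k) [0..<n]"] by simp
    then have "(\<Sum>i<n. e i x * e i x)\<^sup>2 \<le> C * (\<Sum>i<n. (e i x)\<^sup>2)"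
      by (intro LIMSEQ_le[of "\<lambda>k. (\<Sum>i<n. of_rat (q i k) * e i x)\<^sup>2" _
            "\<lambda>k. C * (\<Sum>i<n. (of_rat (q i k))\<^sup>2)"] tendsto_intros lim) auto
    moreover define s where "s = (\<Sum>i<n. (e i x)\<^sup>2)"
    \<comment> \<open>At the coefficients \<open>e i x\<close> both sums of the inequality become
      \<open>s\<close>; cancelling one factor leaves the claim, and \<open>s = 0\<close> falls back
      on \<open>0 \<le> C\<close>.\<close>
    ultimately have "s * s \<le> C * s"
      by (simp add: power2_eq_square)
    moreover have "0 \<le> s" by (simp add: s_def sum_nonneg)
    ultimately have "s \<le> C" using \<open>0 \<le> C\<close> by (cases "s = 0") auto
    then show ?thesis by (simp add: s_def)
  qed
  ultimately show ?thesis
    by (rule eventually_mono)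
qed

lemma (in finite_measure) integrable_mult_of_bounded:
  fixes f g :: "'a \<Rightarrow> real"
  assumes [measurable]: "f \<in> borel_measurable M" "g \<in> borel_measurable M"
    and "AE x in M. \<bar>f x\<bar> \<le> A" "AE x in M. \<bar>g x\<bar> \<le> B"
  shows "integrable M (\<lambda>x. f x * g x)"
proof (rule integrable_const_bound[of _ "\<bar>A\<bar> * \<bar>B\<bar>"])
  show "AE x in M. norm (f x * g x) \<le> \<bar>A\<bar> * \<bar>B\<bar>"
    using assms(3,4) by eventually_elim (auto simp: abs_mult intro!: mult_mono)
qed measurable

lemma linear_combination_closed:
  assumes add: "\<And>f g. f \<in> V \<Longrightarrow> g \<in> V \<Longrightarrow> (\<lambda>x. f x + g x) \<in> V"
    and scale: "\<And>(c::real) f. f \<in> V \<Longrightarrow> (\<lambda>x. c * f x) \<in> V"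
    and zero: "(\<lambda>x. 0) \<in> V"
    and e: "\<And>i. i < (n::nat) \<Longrightarrow> e i \<in> V"
  shows "(\<lambda>x. \<Sum>i<n. c i * e i x) \<in> V"
  using e by (induction n) (auto intro!: zero add scale)

text \<open>The constant \<open>C\<close> caps the length of orthonormal systems, so one of maximal
  length exists. Subtracting from \<open>f\<close> its projection leaves a residual orthogonal to
  the system; if it did not vanish almost everywhere, its normalization would extend the
  system.\<close>

lemma square_integral_spanning_set:
  fixes V :: "('a \<Rightarrow> real) set"
  assumes M: "prob_space M" and meas: "V \<subseteq> borel_measurable M"
    and add: "\<And>f g. f \<in> V \<Longrightarrow> g \<in> V \<Longrightarrow> (\<lambda>x. f x + g x) \<in> V"
    and scale: "\<And>c f. f \<in> V \<Longrightarrow> (\<lambda>x. c * f x) \<in> V"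
    and zero: "(\<lambda>x. 0) \<in> V"
    and bounded: "\<And>f. f \<in> V \<Longrightarrow> \<exists>B. AE x in M. \<bar>f x\<bar> \<le> B"
    and C: "\<And>f. f \<in> V \<Longrightarrow> AE x in M. (f x)\<^sup>2 \<le> C * (\<integral>x. (f x)\<^sup>2 \<partial>M)" and "0 < C"
  shows "\<exists>(n::nat) e. (\<forall>i<n. e i \<in> V) \<and> (\<forall>f\<in>V. \<exists>c. AE x in M. f x = (\<Sum>i<n. c i * e i x))"
proof -
  interpret prob_space M by (rule M)
  have int: "integrable M (\<lambda>x. f x * g x)" if "f \<in> V" "g \<in> V" for f g
    using that meas bounded[OF that(1)] bounded[OF that(2)] integrable_mult_of_bounded by blast
  define ON where "ON n e \<longleftrightarrow> (\<forall>i<n. e i \<in> V) \<and>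
    (\<forall>i<n. \<forall>j<n. (\<integral>x. e i x * e j x \<partial>M) = (if i = j then 1 else 0))"
    for n :: nat and e :: "nat \<Rightarrow> 'a \<Rightarrow> real"
  have inner_sum: "(\<integral>x. g x * (\<Sum>i<n. c i * e i x) \<partial>M) = (\<Sum>i<n. c i * (\<integral>x. g x * e i x \<partial>M))"
    if "ON n e" "g \<in> V" for n e c g
  proof -
    have i: "integrable M (\<lambda>x. g x * e i x)" if "i < n" for i
      using that \<open>ON n e\<close> \<open>g \<in> V\<close> int by (auto simp: ON_def)
    have "(\<integral>x. g x * (\<Sum>i<n. c i * e i x) \<partial>M) = (\<integral>x. (\<Sum>i<n. c i * (g x * e i x)) \<partial>M)"
      by (simp add: sum_distrib_left mult_ac)
    also have "\<dots> = (\<Sum>i<n. c i * (\<integral>x. g x * e i x \<partial>M))"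
      using i by (subst Bochner_Integration.integral_sum) auto
    finally show ?thesis .
  qed
  have comb: "(\<lambda>x. \<Sum>i<n. c i * e i x) \<in> V" if "ON n e" for n e c
    using that by (intro linear_combination_closed add scale zero) (auto simp: ON_def)
  have inner_comb: "(\<integral>x. e j x * (\<Sum>i<n. c i * e i x) \<partial>M) = c j" if "ON n e" "j < n" for n e c j
  proof -
    have "(\<Sum>i<n. c i * (\<integral>x. e j x * e i x \<partial>M)) = (\<Sum>i<n. if i = j then c i else 0)"
      using that by (intro sum.cong) (auto simp: ON_def)
    also have "\<dots> = c j" using that by simp
    finally show ?thesis
      using inner_sum[OF that(1), of "e j" c] that by (simp add: ON_def)
  qed
  have bound: "real n \<le> C" if on: "ON n e" for n e
  proof -
    have "AE x in M. (\<Sum>i<n. c i * e i x)\<^sup>2 \<le> C * (\<Sum>i<n. (c i)\<^sup>2)" for c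
    proof -
      have "(\<integral>x. (\<Sum>i<n. c i * e i x)\<^sup>2 \<partial>M)
          = (\<Sum>i<n. c i * (\<integral>x. (\<Sum>i<n. c i * e i x) * e i x \<partial>M))"
        unfolding power2_eq_square by (rule inner_sum[OF on comb[OF on]])
      also have "\<dots> = (\<Sum>i<n. (c i)\<^sup>2)"
        using inner_comb[OF on] by (simp add: mult.commute power2_eq_square)
      finally show ?thesis
        using C[OF comb[OF on, of c]] by simp
    qed
    then have "AE x in M. (\<Sum>i<n. (e i x)\<^sup>2) \<le> C"
      using \<open>0 < C\<close> by (intro AE_sum_squares_le) auto
    moreover have i2: "integrable M (\<lambda>x. (e i x)\<^sup>2)" if "i < n" for i
      using on that int[of "e i" "e i"] by (auto simp: ON_def power2_eq_square)
    ultimately have "(\<integral>x. (\<Sum>i<n. (e i x)\<^sup>2) \<partial>M) \<le> (\<integral>x. C \<partial>M)"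
      by (intro integral_mono_AE Bochner_Integration.integrable_sum) auto
    moreover have "(\<integral>x. (\<Sum>i<n. (e i x)\<^sup>2) \<partial>M) = (\<Sum>i<n. \<integral>x. (e i x)\<^sup>2 \<partial>M)"
      using i2 by (intro Bochner_Integration.integral_sum) auto
    moreover have "(\<Sum>i<n. \<integral>x. (e i x)\<^sup>2 \<partial>M) = real n"
      using on by (simp add: ON_def power2_eq_square)
    ultimately show ?thesis by (simp add: prob_space)
  qed
  define N where "N = {n. \<exists>e. ON n e}"
  have "N \<subseteq> {..nat \<lfloor>C\<rfloor>}"
    unfolding N_def using bound by (auto simp: le_nat_floor)
  then have fin: "finite N" by (rule finite_subset) simp
  have "0 \<in> N" by (simp add: N_def ON_def)
  define n where "n = Max N"
  have "n \<in> N" unfolding n_def using fin \<open>0 \<in> N\<close> by (intro Max_in) auto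
  then obtain e where on: "ON n e" by (auto simp: N_def)
  show ?thesis
  proof (intro exI[of _ n] exI[of _ e] conjI ballI)
    show "\<forall>i<n. e i \<in> V" using on by (simp add: ON_def)
    fix f assume f: "f \<in> V"
    define c where "c i = (\<integral>x. e i x * f x \<partial>M)" for i
    \<comment> \<open>The difference is written as a sum with a multiple by -1 so that the closure
      properties \<open>add\<close> and \<open>scale\<close> apply directly.\<close>
    define r where "r x = f x + (-1) * (\<Sum>i<n. c i * e i x)" for x
    have rV: "r \<in> V"
      unfolding r_def by (intro add scale f comb on)
    have orth: "(\<integral>x. e j x * r x \<partial>M) = 0" if "j < n" for j
    proof -
      have eV: "e j \<in> V" using on that by (simp add: ON_def)
      have "(\<integral>x. e j x * r x \<partial>M)
          = (\<integral>x. e j x * f x - e j x * (\<Sum>i<n. c i * e i x) \<partial>M)"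
        by (simp add: r_def algebra_simps)
      also have "\<dots> = c j - c j"
        using int[OF eV f] int[OF eV comb[OF on]] inner_comb[OF on that, of c]
        by (subst Bochner_Integration.integral_diff) (auto simp: c_def)
      finally show ?thesis by simp
    qed
    define s where "s = (\<integral>x. r x * r x \<partial>M)"
    have "s = 0"
    proof (rule ccontr)
      assume "s \<noteq> 0"
      moreover have "0 \<le> s" by (simp add: s_def)
      ultimately have s: "0 < s" by simp
      define e' where "e' = e(n := (\<lambda>x. (1 / sqrt s) * r x))"
      have scal: "(\<integral>x. ((1 / sqrt s) * r x) * ((1 / sqrt s) * r x) \<partial>M) = 1"
      proof -
        have "(\<integral>x. ((1 / sqrt s) * r x) * ((1 / sqrt s) * r x) \<partial>M) = (\<integral>x. (1 / s) * (r x * r x) \<partial>M)"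
          using s by (intro Bochner_Integration.integral_cong) auto
        also have "\<dots> = 1"
          using s by (subst integral_mult_right_zero) (simp add: s_def)
        finally show ?thesis .
      qed
      have orth1: "(\<integral>x. e j x * ((1 / sqrt s) * r x) \<partial>M) = 0" if "j < n" for j
      proof -
        have "(\<integral>x. e j x * ((1 / sqrt s) * r x) \<partial>M) = (\<integral>x. (1 / sqrt s) * (e j x * r x) \<partial>M)"
          by (simp add: mult_ac)
        also have "\<dots> = 0" using orth[OF that] by (subst integral_mult_right_zero) simp
        finally show ?thesis .
      qed
      then have orth2: "(\<integral>x. ((1 / sqrt s) * r x) * e j x \<partial>M) = 0" if "j < n" for j
        using that by (simp only: mult.commute[of _ "e j _"])
      have "ON (Suc n) e'"
        unfolding ON_def
      proof (intro conjI allI impI)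
        show "e' i \<in> V" if "i < Suc n" for i
          using that on scale[OF rV, of "1 / sqrt s"] by (auto simp: e'_def ON_def less_Suc_eq)
        show "(\<integral>x. e' i x * e' j x \<partial>M) = (if i = j then 1 else 0)"
          if ij: "i < Suc n" "j < Suc n" for i j
        proof -
          consider "i = n" "j = n" | "i = n" "j < n" | "i < n" "j = n" | "i < n" "j < n"
            using ij by (auto simp: less_Suc_eq)
          then show ?thesis
          proof cases
            case 1
            then show ?thesis using scal unfolding e'_def by (simp only: fun_upd_same simp_thms if_True)
          next
            case 2
            then show ?thesis using orth2[of j] unfolding e'_def by simp
          next
            case 3
            then show ?thesis using orth1[of i] unfolding e'_def by simp
          next
            case 4
            then show ?thesis using on unfolding e'_def ON_def by simp
          qed
        qed
      qed
      then have "Suc n \<in> N" by (auto simp: N_def)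
      then have "Suc n \<le> n" unfolding n_def using fin by (rule Max_ge[rotated])
      then show False by simp
    qed
    then have "AE x in M. r x * r x = 0"
      using integral_nonneg_eq_0_iff_AE[OF int[OF rV rV]] by (simp add: s_def)
    then have "AE x in M. f x = (\<Sum>i<n. c i * e i x)"
      by eventually_elim (simp add: r_def)
    then show "\<exists>c. AE x in M. f x = (\<Sum>i<n. c i * e i x)" by blast
  qed
qed

section \<open>Passage between classes and representatives\<close>

lemma Lp_mem_class:
  assumes "F \<in> Lp M p" "f \<in> F"
  shows "f \<in> Lp_fun M p" "Lp_class M p f = F"
proof -
  obtain g where g: "g \<in> Lp_fun M p" "F = Lp_class M p g"
    using assms(1) by (rule Lp_cases)
  with assms have "f \<in> Lp_fun M p" "AE x in M. g x = f x"
    by (auto simp: mem_Lp_class)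
  then show "f \<in> Lp_fun M p" "Lp_class M p f = F"
    using g Lp_class_eq_iff[of g M p f] by simp_all
qed

text \<open>This lets the analysis run on the set \<Union>\<open>S\<close> of all representatives,
  where sums and multiples are pointwise.\<close>

lemma mem_Union_Lp_iff:
  assumes "S \<subseteq> Lp M p"
  shows "f \<in> \<Union>S \<longleftrightarrow> f \<in> Lp_fun M p \<and> Lp_class M p f \<in> S"
proof
  assume "f \<in> \<Union>S"
  then obtain F where "f \<in> F" "F \<in> S" by blast
  with assms Lp_mem_class[of F M p f] show "f \<in> Lp_fun M p \<and> Lp_class M p f \<in> S" by blast
next
  assume *: "f \<in> Lp_fun M p \<and> Lp_class M p f \<in> S"
  then have "f \<in> Lp_class M p f" by (simp add: mem_Lp_class)
  with * show "f \<in> \<Union>S" by blast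
qed

text \<open>Translates spanning up to null sets by functions into spanning by their classes, as
  required by \<open>Lp_finite_dim\<close>.\<close>

lemma Lp_finite_dimI:
  assumes p: "0 \<le> p" and S: "Lp_subspace M p S"
    and e: "\<And>i. i < (n::nat) \<Longrightarrow> e i \<in> \<Union>S"
    and span: "\<And>f. f \<in> \<Union>S \<Longrightarrow> \<exists>c. AE x in M. f x = (\<Sum>i<n. c i * e i x)"
  shows "Lp_finite_dim M p S"
proof -
  have SL: "S \<subseteq> Lp M p" using S by (simp add: Lp_subspace_def)
  note mem = mem_Union_Lp_iff[OF SL]
  define B where "B = (\<lambda>i. Lp_class M p (e i)) ` {..<n}"
  have eL: "e i \<in> Lp_fun M p" and eS: "Lp_class M p (e i) \<in> S" if "i < n" for i
    using e[OF that] unfolding mem by auto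
  have comb: "(\<lambda>x. \<Sum>i<m. c i * e i x) \<in> Lp_fun M p" if "m \<le> n" for c m
    using that eL
    by (intro linear_combination_closed Lp_fun_add Lp_fun_scale Lp_fun_zero p) auto
  \<comment> \<open>The hull is the intersection of all subspaces containing \<open>B\<close>, so
    membership is shown for an arbitrary such \<open>T\<close>, adding one term at a time.\<close>
  have comb_in: "Lp_class M p (\<lambda>x. \<Sum>i<m. c i * e i x) \<in> T"
    if T: "Lp_subspace M p T" "B \<subseteq> T" and "m \<le> n" for T c m
    using \<open>m \<le> n\<close>
  proof (induction m)
    case 0
    then show ?case using T by (simp add: Lp_subspace_def Lp_zero_def)
  next
    case (Suc m)
    have "Lp_scale M p (c m) (Lp_class M p (e m)) \<in> T"
      using T Suc.prems by (simp add: Lp_subspace_def B_def image_subset_iff)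
    then have "Lp_add M p (Lp_class M p (\<lambda>x. \<Sum>i<m. c i * e i x))
        (Lp_scale M p (c m) (Lp_class M p (e m))) \<in> T"
      using T Suc by (simp add: Lp_subspace_def)
    also have "Lp_scale M p (c m) (Lp_class M p (e m)) = Lp_class M p (\<lambda>x. c m * e m x)"
      using Suc.prems by (intro Lp_scale_class eL) simp
    also have "Lp_add M p (Lp_class M p (\<lambda>x. \<Sum>i<m. c i * e i x)) \<dots>
        = Lp_class M p (\<lambda>x. (\<Sum>i<m. c i * e i x) + c m * e m x)"
      using Suc.prems by (intro Lp_add_class p comb Lp_fun_scale eL) auto
    finally show ?case by simp
  qed
  have "B \<subseteq> S" using eS by (auto simp: B_def)
  moreover have "S \<subseteq> Lp_subspace M p hull B"
  proof
    fix F assume F: "F \<in> S"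
    then obtain f where f: "f \<in> Lp_fun M p" "F = Lp_class M p f"
      using SL Lp_cases[of F M p] by blast
    then have "f \<in> \<Union>S" using F unfolding mem by simp
    then obtain c where "AE x in M. f x = (\<Sum>i<n. c i * e i x)"
      using span by blast
    then have "F = Lp_class M p (\<lambda>x. \<Sum>i<n. c i * e i x)"
      using f comb[of n c] by (simp add: Lp_class_eq_iff)
    then show "F \<in> Lp_subspace M p hull B"
      unfolding hull_def using comb_in[of _ n c] by auto
  qed
  moreover have "Lp_subspace M p hull B \<subseteq> S"
    using \<open>B \<subseteq> S\<close> S by (rule hull_minimal)
  moreover have "finite B" by (simp add: B_def)
  ultimately show ?thesis
    unfolding Lp_finite_dim_def by blast
qed

section \<open>Finite dimension of closed subspaces of essentially bounded classes\<close>

lemma Lp_finite_dim_of_essentially_bounded: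
  assumes M: "prob_space M" and p: "1 \<le> p" and S: "Lp_subspace M p S"
    and closed: "closedin (Lp_topology M p) S"
    and bounded: "\<And>f. f \<in> \<Union>S \<Longrightarrow> \<exists>B. AE x in M. \<bar>f x\<bar> \<le> B"
  shows "Lp_finite_dim M p S"
proof -
  interpret Metric_space "Lp M p" "Lp_dist M p"
    by (rule Metric_space_Lp[OF p])
  have p0: "0 < p" "0 \<le> p" using p by simp_all
  have SL: "S \<subseteq> Lp M p" using S by (simp add: Lp_subspace_def)
  note mem = mem_Union_Lp_iff[OF SL]
  define V where "V = \<Union>S"
  have V: "V \<subseteq> Lp_fun M p"
    unfolding V_def using mem by blast
  have add: "(\<lambda>x. f x + g x) \<in> V" if "f \<in> V" "g \<in> V" for f g
    using that S Lp_add_class[OF p0(2), of f M g] Lp_fun_add[OF p0(2), of f M g]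
    unfolding V_def mem Lp_subspace_def by metis
  have scale: "(\<lambda>x. c * f x) \<in> V" if "f \<in> V" for c f
    using that S Lp_scale_class[of f M p c] Lp_fun_scale[of f M p c]
    unfolding V_def mem Lp_subspace_def by metis
  have zero: "(\<lambda>x. 0) \<in> V"
    using S unfolding V_def mem by (simp add: Lp_fun_zero Lp_subspace_def Lp_zero_def)
  have bdd: "\<exists>B. AE x in M. \<bar>f x\<bar> \<le> B" if "f \<in> V" for f
    using bounded that by (simp add: V_def)
  \<comment> \<open>Topological closedness is turned into sequential closedness for p-th power
    integrals: a class outside \<open>S\<close> has a ball disjoint from \<open>S\<close>, which the
    classes of \<open>u n\<close> would eventually enter.\<close>
  have cl: "g \<in> V" if u: "\<And>n. u n \<in> V" and g: "g \<in> Lp_fun M p"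
    and lim: "(\<lambda>n. \<integral>x. \<bar>g x - u n x\<bar> powr p \<partial>M) \<longlonglongrightarrow> 0" for u :: "nat \<Rightarrow> _" and g
  proof (rule ccontr)
    assume "g \<notin> V"
    then have "Lp_class M p g \<in> Lp M p - S"
      using g mem[of g] by (simp add: V_def Lp_class_in_Lp del: Union_iff)
    then obtain r where r: "0 < r" "disjnt S (mball (Lp_class M p g) r)"
      using closed unfolding Lp_topology_def closedin_metric by blast
    have dist: "Lp_dist M p (Lp_class M p g) (Lp_class M p (u n))
        = (\<integral>x. \<bar>g x - u n x\<bar> powr p \<partial>M) powr (1 / p)" for n
      using u V g by (subst Lp_dist_class[OF p0(2)]) (auto simp: Lp_fun_norm_def)
    have "(\<lambda>n. (\<integral>x. \<bar>g x - u n x\<bar> powr p \<partial>M) powr (1 / p)) \<longlonglongrightarrow> 0 powr (1 / p)"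
      using p by (intro tendsto_powr2 lim tendsto_const) (auto intro!: always_eventually)
    then have "\<forall>\<^sub>F n in sequentially. Lp_dist M p (Lp_class M p g) (Lp_class M p (u n)) < r"
      unfolding dist using r(1) by (intro order_tendstoD(2)) auto
    then obtain n where "Lp_dist M p (Lp_class M p g) (Lp_class M p (u n)) < r"
      by (auto dest: eventually_happens)
    moreover have "Lp_class M p (u n) \<in> S"
      using u[of n] unfolding V_def mem by simp
    ultimately show False
      using r(2) SL g by (auto simp: disjnt_iff Lp_class_in_Lp)
  qed
  have "\<exists>K>0. \<forall>f\<in>V. (\<integral>x. \<bar>f x\<bar> powr p \<partial>M) \<le> 1 \<longrightarrow> (AE x in M. \<bar>f x\<bar> \<le> K)"
    by (rule uniform_essential_bound[OF p0(1) V]) (fact add scale zero bdd cl)+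
  then obtain K where K: "0 < K"
    "\<And>f. f \<in> V \<Longrightarrow> (\<integral>x. \<bar>f x\<bar> powr p \<partial>M) \<le> 1 \<Longrightarrow> AE x in M. \<bar>f x\<bar> \<le> K"
    by blast
  have "\<exists>C>0. \<forall>f\<in>V. AE x in M. (f x)\<^sup>2 \<le> C * (\<integral>x. (f x)\<^sup>2 \<partial>M)"
    by (rule essential_bound_by_square_integral[OF p0(1) M V]) (fact scale K)+
  then obtain C where C: "0 < C" "\<And>f. f \<in> V \<Longrightarrow> AE x in M. (f x)\<^sup>2 \<le> C * (\<integral>x. (f x)\<^sup>2 \<partial>M)"
    by blast
  have meas: "V \<subseteq> borel_measurable M"
    using V by (auto simp: Lp_fun_def)
  have "\<exists>(n::nat) e. (\<forall>i<n. e i \<in> V) \<and> (\<forall>f\<in>V. \<exists>c. AE x in M. f x = (\<Sum>i<n. c i * e i x))"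
    by (rule square_integral_spanning_set[OF M meas]) (fact add scale zero bdd C)+
  then obtain n :: nat and e where e: "\<And>i. i < n \<Longrightarrow> e i \<in> V"
    "\<And>f. f \<in> V \<Longrightarrow> \<exists>c. AE x in M. f x = (\<Sum>i<n. c i * e i x)"
    by blast
  show ?thesis
    using Lp_finite_dimI[OF p0(2) S, of n e] e by (simp add: V_def)
qed

theorem proposition9:
  fixes \<mu> :: "real measure" and p :: real and S :: "(real \<Rightarrow> real) set set"
  assumes "prob_space \<mu>"
    and "sets \<mu> = sets (restrict_space borel {0..1})"
    and "p > 1"
    and "Lp_subspace \<mu> p S"
    and "\<And>F. F \<in> S \<Longrightarrow> \<exists>f\<in>F. continuous_on {0..1} f"
    and "closedin (Lp_topology \<mu> p) S"
  shows "Lp_finite_dim \<mu> p S"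
proof (rule Lp_finite_dim_of_essentially_bounded)
  have space: "space \<mu> = {0..1}"
    using sets_eq_imp_space_eq[OF assms(2)] by (simp add: space_restrict_space)
  fix f assume "f \<in> \<Union>S"
  then have f: "f \<in> Lp_fun \<mu> p" "Lp_class \<mu> p f \<in> S"
    using assms(4) mem_Union_Lp_iff[of S \<mu> p f] by (auto simp: Lp_subspace_def)
  \<comment> \<open>\<open>f\<close> itself may be discontinuous, but it agrees almost everywhere
    with a continuous representative of its class, which is bounded by compactness of the
    interval.\<close>
  then obtain h where h: "h \<in> Lp_class \<mu> p f" "continuous_on {0..1} h"
    using assms(5) by blast
  have "bounded (h ` {0..1})"
    using h(2) by (intro compact_imp_bounded compact_continuous_image) auto
  then obtain B where B: "\<And>x. x \<in> {0..1} \<Longrightarrow> \<bar>h x\<bar> \<le> B"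
    unfolding bounded_iff by (metis image_eqI real_norm_def)
  have "AE x in \<mu>. f x = h x"
    using h(1) by (simp add: mem_Lp_class)
  then have "AE x in \<mu>. \<bar>f x\<bar> \<le> B"
    using AE_space by eventually_elim (use B space in auto)
  then show "\<exists>B. AE x in \<mu>. \<bar>f x\<bar> \<le> B" by blast
qed (use assms in auto)

end
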